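(* Let $\mu\in\mathbb{C}$. For all integers $m,n$ for which every polynomial occurring has first index $\ge0$ and second index $\ge1$ (i.e. $m\ge1,n\ge2$ for the first equation and $m\ge0,n\ge2$ for the second), the generalised Laguerre polynomials satisfy $$T_{m,n+1}^{(\mu-1)}\,T_{m,n-1}^{(\mu+1)}=T_{m+1,n}^{(\mu-1)}\,T_{m-1,n}^{(\mu+1)}-\left(T_{m,n}^{(\mu)}\right)^2,$$ $$T_{m,n+1}^{(\mu-1)}\,T_{m+1,n-1}^{(\mu+1)}=T_{m+1,n}^{(\mu-1)}\,T_{m,n}^{(\mu+1)}-T_{m+1,n}^{(\mu)}\,T_{m,n}^{(\mu)} .$$
   Context: $L_n^{(\alpha)}(z)=\sum_{i=0}^n \frac{(-1)^i}{i!\,(n-i)!}\Big(\prod_{l=i+1}^{n}(\alpha+l)\Big)z^i$ is the associated Laguerre polynomial ($n\ge0$, any complex $\alpha$). The generalised Laguerre polynomial is $T_{m,n}^{(\mu)}(z)=\det\left[\frac{d^{j+k}}{dz^{j+k}}L_{m+n}^{(\mu+1)}(z)\right]_{j,k=0}^{n-1}$ for integers $m\ge0$, $n\ge1$. All polynomials in the claim are evaluated at the same $z$. *)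

theory Defs
  imports
    Complex_Main
    "HOL-Computational_Algebra.Polynomial"
    "Jordan_Normal_Form.Determinant"
begin

definition laguerre :: "complex \<Rightarrow> nat \<Rightarrow> complex poly" where
  "laguerre \<alpha> n =
     (\<Sum>i\<le>n. monom ((-1) ^ i / (fact i * fact (n - i)) * (\<Prod>l=i+1..n. \<alpha> + of_nat l)) i)"

definition gen_laguerre :: "complex \<Rightarrow> nat \<Rightarrow> nat \<Rightarrow> complex poly" where
  "gen_laguerre \<mu> m n =
     det (mat n n (\<lambda>(j, k). (pderiv ^^ (j + k)) (laguerre (\<mu> + 1) (m + n))))"

end

theory Submission
  imports Defs "Jordan_Normal_Form.Char_Poly"
begin

text \<open>Put \<open>f = L\<^bsub>m+n+1\<^esub>\<^bsup>(\<mu>)\<^esup>\<close> and \<open>g = f - D f\<close>. Since \<open>D L\<^bsub>k+1\<^esub>\<^bsup>(\<alpha>)\<^esup> = - L\<^bsub>k\<^esub>\<^bsup>(\<alpha>+1)\<^esup>\<close> and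
  \<open>L\<^bsub>k\<^esub>\<^bsup>(\<alpha>+1)\<^esup> = L\<^bsub>k\<^esub>\<^bsup>(\<alpha>)\<^esup> - D L\<^bsub>k\<^esub>\<^bsup>(\<alpha>)\<^esup>\<close>, all determinants in the claim are, up to sign, Hankel determinants
  built from the derivatives of \<open>f\<close> or of \<open>g\<close>. Both equations are then the Desnanot--Jacobi identity,
  applied to the Hankel matrix of \<open>f\<close> and to a column-reduced form of it. The Desnanot--Jacobi
  identity itself follows by multiplying \<open>A\<close> with the identity matrix whose first and last columns
  are replaced by those of the adjugate of \<open>A\<close>.\<close>

section \<open>The Desnanot-Jacobi identity\<close>

text \<open>Row 0 has at most two nonzero entries. One complementary minor is upper triangular; the
  last row of the other contains only \<open>u (Suc n)\<close>.\<close>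

lemma det_replace_outer_cols_one_mat:
  fixes u v :: "nat \<Rightarrow> 'a :: comm_ring_1" and n :: nat
  defines "M \<equiv> mat (Suc (Suc n)) (Suc (Suc n))
    (\<lambda>(i, j). if j = 0 then u i else if j = Suc n then v i else if i = j then 1 else 0)"
  shows "det M = u 0 * v (Suc n) - v 0 * u (Suc n)"
proof -
  have M: "M \<in> carrier_mat (Suc (Suc n)) (Suc (Suc n))"
    by (simp add: M_def)
  have "det M = (\<Sum>j<Suc (Suc n). M $$ (0, j) * cofactor M 0 j)"
    by (rule laplace_expansion_row[OF M]) simp
  also have "\<dots> = u 0 * cofactor M 0 0 + v 0 * cofactor M 0 (Suc n)"
    by (subst sum.lessThan_Suc_shift, subst sum.lessThan_Suc) (simp add: M_def)
  also have "cofactor M 0 0 = v (Suc n)"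
  proof -
    have "upper_triangular (mat_delete M 0 0)"
      by (auto simp: upper_triangular_def mat_delete_def M_def)
    then have "det (mat_delete M 0 0) = prod_list (diag_mat (mat_delete M 0 0))"
      by (rule det_upper_triangular) (rule mat_delete_carrier[OF M])
    also have "diag_mat (mat_delete M 0 0) = replicate n 1 @ [v (Suc n)]"
      by (rule nth_equalityI) (auto simp: diag_mat_def mat_delete_def M_def nth_append)
    finally show ?thesis by (simp add: cofactor_def)
  qed
  also have "cofactor M 0 (Suc n) = - u (Suc n)"
  proof -
    let ?B = "mat_delete M 0 (Suc n)"
    have B: "?B \<in> carrier_mat (Suc n) (Suc n)"
      using mat_delete_carrier[OF M] by simp
    have "det ?B = (\<Sum>j<Suc n. ?B $$ (n, j) * cofactor ?B n j)"
      by (rule laplace_expansion_row[OF B]) simp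
    also have "\<dots> = u (Suc n) * cofactor ?B n 0"
      by (subst sum.lessThan_Suc_shift) (simp add: mat_delete_def M_def)
    also have "mat_delete ?B n 0 = 1\<^sub>m n"
      by (rule eq_matI) (auto simp: mat_delete_def M_def)
    then have "cofactor ?B n 0 = (-1) ^ n"
      by (simp add: cofactor_def)
    finally show ?thesis
      by (simp add: cofactor_def power_add[symmetric] mult.left_commute)
  qed
  finally show ?thesis by simp
qed

text \<open>The shape that \<open>A\<close> takes when its outer columns are replaced by those of
  \<open>A * adj_mat A\<close>; two column expansions strip them off.\<close>

lemma det_outer_cols_unit:
  fixes a :: "nat \<Rightarrow> nat \<Rightarrow> 'a :: comm_ring_1" and d :: 'a and n :: nat
  defines "M \<equiv> mat (Suc (Suc n)) (Suc (Suc n))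
    (\<lambda>(i, j). if j = 0 then (if i = 0 then d else 0)
       else if j = Suc n then (if i = Suc n then d else 0) else a i j)"
  shows "det M = d * d * det (mat n n (\<lambda>(i, j). a (Suc i) (Suc j)))"
proof -
  have M: "M \<in> carrier_mat (Suc (Suc n)) (Suc (Suc n))"
    by (simp add: M_def)
  let ?B = "mat_delete M 0 0"
  have B: "?B \<in> carrier_mat (Suc n) (Suc n)"
    using mat_delete_carrier[OF M] by simp
  have "det M = (\<Sum>i<Suc (Suc n). M $$ (i, 0) * cofactor M i 0)"
    by (rule laplace_expansion_column[OF M]) simp
  also have "\<dots> = d * det ?B"
    by (subst sum.lessThan_Suc_shift) (simp add: M_def cofactor_def)
  also have "det ?B = (\<Sum>i<Suc n. ?B $$ (i, n) * cofactor ?B i n)"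
    by (rule laplace_expansion_column[OF B]) simp
  also have "\<dots> = d * det (mat_delete ?B n n)"
    by (subst sum.lessThan_Suc) (simp add: M_def mat_delete_def cofactor_def power_add[symmetric])
  also have "mat_delete ?B n n = mat n n (\<lambda>(i, j). a (Suc i) (Suc j))"
    by (rule eq_matI) (auto simp: mat_delete_def M_def)
  finally show ?thesis by (simp add: mult.assoc)
qed

text \<open>Taking determinants in \<open>A * ?M = ?R\<close> leaves a factor \<open>det A\<close>
  on both sides, which cannot be cancelled over an arbitrary commutative ring.\<close>

lemma desnanot_jacobi_times_det:
  fixes A :: "'a :: comm_ring_1 mat"
  assumes A: "A \<in> carrier_mat (Suc (Suc n)) (Suc (Suc n))"
  shows "det A * (det A * det (mat_delete (mat_delete A 0 0) n n)) =
    det A * (det (mat_delete A 0 0) * det (mat_delete A (Suc n) (Suc n))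
      - det (mat_delete A 0 (Suc n)) * det (mat_delete A (Suc n) 0))"
proof -
  let ?N = "Suc (Suc n)"
  let ?M = "mat ?N ?N (\<lambda>(i, j). if j = 0 then cofactor A 0 i
    else if j = Suc n then cofactor A (Suc n) i else if i = j then 1 else 0)"
  let ?R = "mat ?N ?N (\<lambda>(i, j). if j = 0 then (if i = 0 then det A else 0)
    else if j = Suc n then (if i = Suc n then det A else 0) else A $$ (i, j))"
  have adj: "(\<Sum>k<?N. A $$ (i, k) * cofactor A j k) = (if i = j then det A else 0)"
    if "i < ?N" "j < ?N" for i j
  proof -
    have "(A * adj_mat A) $$ (i, j) = (\<Sum>k<?N. A $$ (i, k) * cofactor A j k)"
      using that A by (simp add: times_mat_def scalar_prod_def adj_mat_def atLeast0LessThan)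
    then show ?thesis using that by (simp add: adj_mat(2)[OF A] del: sum.lessThan_Suc split: if_splits)
  qed
  have "A * ?M = ?R"
  proof (rule eq_matI)
    fix i j assume "i < dim_row ?R" "j < dim_col ?R"
    then have ij: "i < ?N" "j < ?N" by auto
    have "(A * ?M) $$ (i, j) = (\<Sum>k<?N. A $$ (i, k) * ?M $$ (k, j))"
      using ij A by (simp add: times_mat_def scalar_prod_def atLeast0LessThan)
    also have "\<dots> = (\<Sum>k<?N. A $$ (i, k) * (if j = 0 then cofactor A 0 k
        else if j = Suc n then cofactor A (Suc n) k else if k = j then 1 else 0))"
      using ij by (intro sum.cong) auto
    also have "\<dots> = ?R $$ (i, j)"
    proof -
      consider "j = 0" | "j = Suc n" | "j \<noteq> 0" "j \<noteq> Suc n" by blast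
      then show ?thesis
      proof cases
        case 3
        then have "(\<Sum>k<?N. A $$ (i, k) * (if j = 0 then cofactor A 0 k
            else if j = Suc n then cofactor A (Suc n) k else if k = j then 1 else 0)) =
          (\<Sum>k<?N. if k = j then A $$ (i, k) else 0)"
          by (intro sum.cong) auto
        also have "\<dots> = A $$ (i, j)"
          using ij by (subst sum.delta) auto
        finally show ?thesis using 3 ij by simp
      qed (use ij adj[OF ij] in \<open>simp_all del: sum.lessThan_Suc\<close>)
    qed
    finally show "(A * ?M) $$ (i, j) = ?R $$ (i, j)" .
  qed (use A in auto)
  then have "det A * det ?M = det ?R"
    using det_mult[OF A, of ?M] by simp
  moreover have "mat n n (\<lambda>(i, j). A $$ (Suc i, Suc j)) = mat_delete (mat_delete A 0 0) n n"
    using A by (intro eq_matI) (auto simp: mat_delete_def)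
  \<comment> \<open>The two mixed corner cofactors both carry the sign \<open>(-1) ^ Suc n\<close>,
    which cancels in their product.\<close>
  ultimately show ?thesis
    unfolding det_replace_outer_cols_one_mat det_outer_cols_unit[of n "det A" "\<lambda>i j. A $$ (i, j)"]
    by (simp add: cofactor_def mult.assoc power_add[symmetric] mult.left_commute)
      (simp add: algebra_simps flip: power_mult_distrib)
qed

text \<open>The factor \<open>det A\<close> is cancelled generically: for the matrix \<open>x \<cdot> 1 - A\<close> over the polynomial
  ring it is the characteristic polynomial of \<open>A\<close>, which is monic. Evaluating the resulting identity
  for \<open>- A\<close> at \<open>x = 0\<close> gives the claim without any invertibility assumption.\<close>

theorem desnanot_jacobi:
  fixes A :: "'a :: idom mat"
  assumes A: "A \<in> carrier_mat (Suc (Suc n)) (Suc (Suc n))"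
  shows "det A * det (mat_delete (mat_delete A 0 0) n n) =
    det (mat_delete A 0 0) * det (mat_delete A (Suc n) (Suc n))
      - det (mat_delete A 0 (Suc n)) * det (mat_delete A (Suc n) 0)"
proof -
  let ?P = "char_poly_matrix (- A)"
  have P: "?P \<in> carrier_mat (Suc (Suc n)) (Suc (Suc n))"
    using A by simp
  have "det ?P \<noteq> 0"
    using degree_monic_char_poly[of "- A" "Suc (Suc n)"] A
    by (auto simp: char_poly_def)
  then have eq: "det ?P * det (mat_delete (mat_delete ?P 0 0) n n) =
    det (mat_delete ?P 0 0) * det (mat_delete ?P (Suc n) (Suc n))
      - det (mat_delete ?P 0 (Suc n)) * det (mat_delete ?P (Suc n) 0)"
    using desnanot_jacobi_times_det[OF P] by simp
  have ev: "poly (?P $$ (i, j)) 0 = A $$ (i, j)" if "i < Suc (Suc n)" "j < Suc (Suc n)" for i j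
    using that A by (auto simp: char_poly_matrix_def)
  have ev0: "poly (det ?P) 0 = det A"
    by (rule poly_det_cong[OF A P ev])
  have ev1: "poly (det (mat_delete ?P i j)) 0 = det (mat_delete A i j)" for i j
    by (rule poly_det_cong[of _ "Suc n"])
      (use carrier_matD[OF A] carrier_matD[OF P] in \<open>auto simp: mat_delete_def ev\<close>)
  have ev2: "poly (det (mat_delete (mat_delete ?P i j) k l)) 0 = det (mat_delete (mat_delete A i j) k l)"
    for i j k l
    by (rule poly_det_cong[of _ n])
      (use carrier_matD[OF A] carrier_matD[OF P] in \<open>auto simp: mat_delete_def ev\<close>)
  show ?thesis
    using arg_cong[OF eq, of "\<lambda>p. poly p 0"] by (simp add: ev0 ev1 ev2)
qed

section \<open>Hankel determinants of iterated derivatives\<close>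

text \<open>The column operations amount to right multiplication by an upper bidiagonal matrix with
  diagonal 1, -1, ..., -1.\<close>

lemma det_consecutive_col_diffs:
  fixes a :: "nat \<Rightarrow> nat \<Rightarrow> 'a :: idom" and n :: nat
  defines "A \<equiv> mat (Suc n) (Suc n) (\<lambda>(i, j). a i j)"
  shows "det (mat (Suc n) (Suc n) (\<lambda>(i, j). if j = 0 then a i 0 else a i (j - 1) - a i j)) =
    (-1) ^ n * det A"
proof -
  let ?U = "mat (Suc n) (Suc n) (\<lambda>(i, j). if i = j then (if j = 0 then 1 else -1)
    else if Suc i = j then 1 else 0) :: 'a mat"
  let ?R = "mat (Suc n) (Suc n) (\<lambda>(i, j). if j = 0 then a i 0 else a i (j - 1) - a i j)"
  have A: "A \<in> carrier_mat (Suc n) (Suc n)" by (simp add: A_def)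
  have "A * ?U = ?R"
  proof (rule eq_matI)
    fix i j assume "i < dim_row ?R" "j < dim_col ?R"
    then have ij: "i < Suc n" "j < Suc n" by auto
    have "(A * ?U) $$ (i, j) = (\<Sum>k<Suc n. a i k * (if k = j then (if j = 0 then 1 else -1)
        else if Suc k = j then 1 else 0))"
      using ij by (simp add: A_def times_mat_def scalar_prod_def atLeast0LessThan)
    \<comment> \<open>For \<open>j = 0\<close> the truncated \<open>j - 1\<close> is again 0; the
      inner case distinction removes this spurious term.\<close>
    also have "\<dots> = (\<Sum>k<Suc n. (if k = j then a i k * (if j = 0 then 1 else -1) else 0)
        + (if k = j - 1 then (if j = 0 then 0 else a i k) else 0))"
      by (intro sum.cong) auto
    also have "\<dots> = ?R $$ (i, j)"
      using ij by (subst sum.distrib, subst sum.delta, simp, subst sum.delta) auto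
    finally show "(A * ?U) $$ (i, j) = ?R $$ (i, j)" .
  qed (auto simp: A_def)
  moreover have "det ?U = (-1) ^ n"
  proof -
    have "det ?U = prod_list (diag_mat ?U)"
      by (rule det_upper_triangular) (auto simp: upper_triangular_def)
    also have "diag_mat ?U = 1 # replicate n (-1)"
      by (rule nth_equalityI) (auto simp: diag_mat_def nth_Cons simp del: upt_Suc split: nat.split)
    finally show ?thesis by simp
  qed
  ultimately show ?thesis
    using det_mult[OF A, of ?U] by simp
qed

text \<open>This is the Wronskian of \<open>f\<close> and its successive derivatives up to order
  \<open>n - 1\<close>.\<close>

definition hankel_det :: "nat \<Rightarrow> 'a :: idom poly \<Rightarrow> 'a poly" where
  "hankel_det n f = det (mat n n (\<lambda>(j, k). (pderiv ^^ (j + k)) f))"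

lemma gen_laguerre_eq_hankel_det:
  "gen_laguerre \<mu> m n = hankel_det n (laguerre (\<mu> + 1) (m + n))"
  by (simp add: gen_laguerre_def hankel_det_def)

lemma funpow_pderiv_uminus:
  "(pderiv ^^ k) (- f :: 'a :: idom poly) = - (pderiv ^^ k) f"
  by (induction k) (simp_all add: pderiv_minus)

lemma funpow_pderiv_diff:
  "(pderiv ^^ k) (f - g :: 'a :: idom poly) = (pderiv ^^ k) f - (pderiv ^^ k) g"
  by (induction k) (simp_all add: pderiv_diff)

lemma hankel_det_uminus: "hankel_det n (- f) = (-1) ^ n * hankel_det n f"
proof -
  have "mat n n (\<lambda>(j, k). (pderiv ^^ (j + k)) (- f)) =
    (-1) \<cdot>\<^sub>m mat n n (\<lambda>(j, k). (pderiv ^^ (j + k)) f)"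
    by (rule eq_matI) (auto simp: funpow_pderiv_uminus)
  then show ?thesis by (simp add: hankel_det_def)
qed

text \<open>Deleting the first row or the first column raises the order of every derivative by one,
  so all minors are again Hankel; the two mixed ones coincide and give the square.\<close>

lemma hankel_det_toda:
  "hankel_det (Suc (Suc n)) f * hankel_det n (pderiv (pderiv f)) =
    hankel_det (Suc n) f * hankel_det (Suc n) (pderiv (pderiv f)) - (hankel_det (Suc n) (pderiv f))\<^sup>2"
proof -
  let ?A = "mat (Suc (Suc n)) (Suc (Suc n)) (\<lambda>(j, k). (pderiv ^^ (j + k)) f)"
  have "mat_delete (mat_delete ?A 0 0) n n = mat n n (\<lambda>(j, k). (pderiv ^^ (j + k)) (pderiv (pderiv f)))"
    "mat_delete ?A 0 0 = mat (Suc n) (Suc n) (\<lambda>(j, k). (pderiv ^^ (j + k)) (pderiv (pderiv f)))"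
    "mat_delete ?A (Suc n) (Suc n) = mat (Suc n) (Suc n) (\<lambda>(j, k). (pderiv ^^ (j + k)) f)"
    "mat_delete ?A 0 (Suc n) = mat (Suc n) (Suc n) (\<lambda>(j, k). (pderiv ^^ (j + k)) (pderiv f))"
    "mat_delete ?A (Suc n) 0 = mat (Suc n) (Suc n) (\<lambda>(j, k). (pderiv ^^ (j + k)) (pderiv f))"
    by (auto intro: eq_matI simp: mat_delete_def funpow_swap1[of pderiv, symmetric])
  then show ?thesis
    using desnanot_jacobi[of ?A n] by (simp add: hankel_det_def power2_eq_square mult.commute)
qed

text \<open>Apply the Desnanot--Jacobi identity after replacing the columns \<open>D\<^sup>k f\<close>, \<open>k \<ge> 1\<close>, of the Hankel
  matrix by \<open>D\<^sup>k\<^sup>-\<^sup>1 (f - D f)\<close>.\<close>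

lemma hankel_det_shifted_toda:
  fixes f :: "'a :: idom poly" and n :: nat
  defines "g \<equiv> f - pderiv f"
  shows "hankel_det (Suc (Suc n)) f * hankel_det n (pderiv g) =
    hankel_det (Suc n) (pderiv f) * hankel_det (Suc n) g - hankel_det (Suc n) f * hankel_det (Suc n) (pderiv g)"
proof -
  let ?N = "Suc (Suc n)"
  let ?a = "\<lambda>j k. (pderiv ^^ (j + k)) f"
  let ?B = "mat ?N ?N (\<lambda>(j, k). if k = 0 then ?a j 0 else ?a j (k - 1) - ?a j k)"
  have g: "(pderiv ^^ k) g = (pderiv ^^ k) f - (pderiv ^^ Suc k) f" for k
    unfolding g_def funpow_pderiv_diff funpow_Suc_right o_apply ..
  have g': "(pderiv ^^ k) (pderiv g) = (pderiv ^^ Suc k) f - (pderiv ^^ Suc (Suc k)) f" for k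
    using g[of "Suc k"] unfolding funpow_Suc_right o_apply .
  have f': "(pderiv ^^ k) (pderiv f) = (pderiv ^^ Suc k) f" for k
    unfolding funpow_Suc_right o_apply ..
  have B: "det ?B = (-1) ^ Suc n * hankel_det ?N f"
    unfolding hankel_det_def by (rule det_consecutive_col_diffs)
  have "mat_delete ?B (Suc n) (Suc n) =
    mat (Suc n) (Suc n) (\<lambda>(j, k). if k = 0 then ?a j 0 else ?a j (k - 1) - ?a j k)"
    by (auto intro: eq_matI simp: mat_delete_def)
  then have B1: "det (mat_delete ?B (Suc n) (Suc n)) = (-1) ^ n * hankel_det (Suc n) f"
    unfolding hankel_det_def by (simp only: det_consecutive_col_diffs[of n ?a])
  have "mat_delete ?B 0 (Suc n) =
    mat (Suc n) (Suc n) (\<lambda>(j, k). if k = 0 then ?a (Suc j) 0 else ?a (Suc j) (k - 1) - ?a (Suc j) k)"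
    by (auto intro: eq_matI simp: mat_delete_def)
  then have B2: "det (mat_delete ?B 0 (Suc n)) = (-1) ^ n * hankel_det (Suc n) (pderiv f)"
    unfolding hankel_det_def f' by (simp only: det_consecutive_col_diffs[of n "\<lambda>j k. (pderiv ^^ Suc (j + k)) f"] add_Suc)
  \<comment> \<open>Without column 0 only difference columns remain, and these consist of
    derivatives of \<open>g\<close>.\<close>
  have B3: "mat_delete ?B 0 0 = mat (Suc n) (Suc n) (\<lambda>(j, k). (pderiv ^^ (j + k)) (pderiv g))"
    "mat_delete (mat (Suc n) (Suc n) (\<lambda>(j, k). (pderiv ^^ (j + k)) (pderiv g))) n n =
      mat n n (\<lambda>(j, k). (pderiv ^^ (j + k)) (pderiv g))"
    "mat_delete ?B (Suc n) 0 = mat (Suc n) (Suc n) (\<lambda>(j, k). (pderiv ^^ (j + k)) g)"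
    by (auto intro: eq_matI simp: mat_delete_def g g')
  \<comment> \<open>\<open>det ?B\<close> has one sign more than the two minors in \<open>B1\<close>
    and \<open>B2\<close>, which swaps the products on the right.\<close>
  have "(-1) ^ n * (hankel_det ?N f * hankel_det n (pderiv g)) =
    (-1) ^ n * (hankel_det (Suc n) (pderiv f) * hankel_det (Suc n) g
      - hankel_det (Suc n) f * hankel_det (Suc n) (pderiv g))"
    using desnanot_jacobi[of ?B n] unfolding B B1 B2 B3 hankel_det_def[symmetric]
    by (simp add: algebra_simps)
  then show ?thesis by simp
qed

section \<open>Derivative and parameter shift of Laguerre polynomials\<close>

lemma coeff_laguerre:
  "coeff (laguerre \<alpha> n) i =
    (if i \<le> n then (-1) ^ i / (fact i * fact (n - i)) * (\<Prod>l=i+1..n. \<alpha> + of_nat l) else 0)"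
  by (simp add: laguerre_def coeff_sum)

lemma pderiv_laguerre_Suc: "pderiv (laguerre \<alpha> (Suc n)) = - laguerre (\<alpha> + 1) n"
proof (rule poly_eqI)
  fix i
  have "(\<Prod>l=i+1..n. \<alpha> + 1 + of_nat l) = (\<Prod>l=Suc i+1..Suc n. \<alpha> + of_nat l)"
    by (rule prod.reindex_bij_witness[of _ "\<lambda>l. l - 1" Suc]) auto
  then show "coeff (pderiv (laguerre \<alpha> (Suc n))) i = coeff (- laguerre (\<alpha> + 1) n) i"
    by (simp add: coeff_pderiv coeff_laguerre field_simps del: of_nat_Suc)
qed

text \<open>For \<open>i < n\<close> the coefficients share the product over
  \<open>l = i+2..n\<close>; what remains is
  \<open>\<alpha> + n + 1 = (\<alpha> + i + 1) + (n - i)\<close>.\<close>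

lemma laguerre_plus_one: "laguerre (\<alpha> + 1) n = laguerre \<alpha> n - pderiv (laguerre \<alpha> n)"
proof (rule poly_eqI)
  fix i
  consider "i < n" | "i = n" | "i > n" by linarith
  then show "coeff (laguerre (\<alpha> + 1) n) i = coeff (laguerre \<alpha> n - pderiv (laguerre \<alpha> n)) i"
  proof cases
    case 1
    define P where "P = (\<Prod>l=i+2..n. \<alpha> + of_nat l)"
    define d where "d = n - Suc i"
    have n: "n = Suc (i + d)" using 1 by (simp add: d_def)
    have P1: "(\<Prod>l=i+1..n. \<alpha> + of_nat l) = (\<alpha> + of_nat (i + 1)) * P"
      unfolding P_def using 1 by (subst prod.atLeast_Suc_atMost) auto
    have "(\<Prod>l=i+1..n. \<alpha> + 1 + of_nat l) = (\<Prod>l=i+2..Suc n. \<alpha> + of_nat l)"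
      by (rule prod.reindex_bij_witness[of _ "\<lambda>l. l - 1" Suc]) auto
    also have "\<dots> = (\<alpha> + of_nat (Suc n)) * P"
      unfolding P_def using 1 by (subst prod.nat_ivl_Suc') auto
    finally have P2: "(\<Prod>l=i+1..n. \<alpha> + 1 + of_nat l) = (\<alpha> + of_nat (Suc n)) * P" .
    have P3: "(\<Prod>l=Suc i+1..n. \<alpha> + of_nat l) = P"
      by (simp add: P_def)
    have "of_nat (Suc d) \<noteq> (0 :: complex)" "of_nat (Suc i) \<noteq> (0 :: complex)"
      by (simp_all only: of_nat_eq_0_iff nat.simps not_False_eq_True)
    then show ?thesis
      using 1 unfolding coeff_diff coeff_pderiv coeff_laguerre P1 P2 P3
      by (simp add: n divide_simps) (simp add: algebra_simps)
  qed (simp_all add: coeff_laguerre coeff_pderiv)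
qed

section \<open>The two equations for generalised Laguerre polynomials\<close>

theorem lemma3p12:
  fixes \<mu> z :: complex and m n :: nat
  assumes "n \<ge> 2"
  shows "(m \<ge> 1 \<longrightarrow>
            poly (gen_laguerre (\<mu> - 1) m (n + 1)) z * poly (gen_laguerre (\<mu> + 1) m (n - 1)) z
          = poly (gen_laguerre (\<mu> - 1) (m + 1) n) z * poly (gen_laguerre (\<mu> + 1) (m - 1) n) z
            - (poly (gen_laguerre \<mu> m n) z)\<^sup>2)
       \<and> poly (gen_laguerre (\<mu> - 1) m (n + 1)) z * poly (gen_laguerre (\<mu> + 1) (m + 1) (n - 1)) z
          = poly (gen_laguerre (\<mu> - 1) (m + 1) n) z * poly (gen_laguerre (\<mu> + 1) m n) z
            - poly (gen_laguerre \<mu> (m + 1) n) z * poly (gen_laguerre \<mu> m n) z"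
proof -
  obtain p where n: "n = Suc p" using assms by (cases n) auto
  \<comment> \<open>Both polynomials with parameter \<open>\<mu> - 1\<close> are Hankel determinants
    of this \<open>f\<close>, as their two indices add up to \<open>m + n + 1\<close>.\<close>
  define f where "f = laguerre \<mu> (Suc (m + n))"
  define g where "g = f - pderiv f"
  have g: "g = laguerre (\<mu> + 1) (Suc (m + n))"
    by (simp add: f_def g_def laguerre_plus_one)
  have Df: "laguerre (\<mu> + 1) (m + n) = - pderiv f"
    by (simp add: f_def pderiv_laguerre_Suc)
  have Dg: "laguerre (\<mu> + 2) (m + n) = - pderiv g"
    by (simp add: g pderiv_laguerre_Suc add.assoc)
  have T: "gen_laguerre (\<mu> - 1) m (n + 1) = hankel_det (Suc (Suc p)) f"
    "gen_laguerre (\<mu> - 1) (m + 1) n = hankel_det (Suc p) f"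
    "gen_laguerre \<mu> m n = (-1) ^ Suc p * hankel_det (Suc p) (pderiv f)"
    "gen_laguerre \<mu> (m + 1) n = hankel_det (Suc p) g"
    "gen_laguerre (\<mu> + 1) m n = (-1) ^ Suc p * hankel_det (Suc p) (pderiv g)"
    "gen_laguerre (\<mu> + 1) (m + 1) (n - 1) = (-1) ^ p * hankel_det p (pderiv g)"
    using Df Dg
    by (simp_all add: gen_laguerre_eq_hankel_det n f_def g add.assoc hankel_det_uminus)
  have "poly (gen_laguerre (\<mu> - 1) m (n + 1)) z * poly (gen_laguerre (\<mu> + 1) m (n - 1)) z
      = poly (gen_laguerre (\<mu> - 1) (m + 1) n) z * poly (gen_laguerre (\<mu> + 1) (m - 1) n) z
        - (poly (gen_laguerre \<mu> m n) z)\<^sup>2" if m1: "m \<ge> 1"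
  proof -
    \<comment> \<open>For \<open>m = 0\<close> the truncated \<open>m - 1\<close> would give the
      wrong Laguerre index.\<close>
    obtain q where m: "m = Suc q" using m1 by (cases m) auto
    have DDf: "pderiv (pderiv f) = laguerre (\<mu> + 2) (m + p)"
      by (simp add: f_def pderiv_laguerre_Suc pderiv_minus m n add.assoc)
    have T': "gen_laguerre (\<mu> + 1) m (n - 1) = hankel_det p (pderiv (pderiv f))"
      "gen_laguerre (\<mu> + 1) (m - 1) n = hankel_det (Suc p) (pderiv (pderiv f))"
      by (simp_all add: gen_laguerre_eq_hankel_det DDf m n add.assoc)
    show ?thesis
      unfolding T T' using arg_cong[OF hankel_det_toda[of p f], of "\<lambda>p. poly p z"]
      by (simp add: power_mult_distrib power2_eq_square[of "(-1) ^ p"])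
  qed
  moreover have "poly (gen_laguerre (\<mu> - 1) m (n + 1)) z * poly (gen_laguerre (\<mu> + 1) (m + 1) (n - 1)) z
      = poly (gen_laguerre (\<mu> - 1) (m + 1) n) z * poly (gen_laguerre (\<mu> + 1) m n) z
        - poly (gen_laguerre \<mu> (m + 1) n) z * poly (gen_laguerre \<mu> m n) z"
    \<comment> \<open>The factor \<open>(-1) ^ p\<close> supplies the signs from \<open>T\<close>;
      those of size \<open>Suc p\<close> have one more, which restores the order of the
      products.\<close>
    unfolding T using arg_cong[OF hankel_det_shifted_toda[of p f, folded g_def], of "\<lambda>q. (-1) ^ p * poly q z"]
    by (simp add: algebra_simps)
  ultimately show ?thesis by blast
qed

end
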